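(* Let $\gamma>1$ and let $\mathbf U_-,\mathbf U_+$ be any two states of the three-dimensional compressible Euler equations with positive density and pressure. Then the temporal state $$\mathbf U^{\#}=\begin{bmatrix}\rho^{\ln}\\ \rho^{\ln}\{\!\{v_1\}\!\}\\ \rho^{\ln}\{\!\{v_2\}\!\}\\ \rho^{\ln}\{\!\{v_3\}\!\}\\ \dfrac{\rho^{\ln}}{2\beta^{\ln}(\gamma-1)}+\rho^{\ln}\Big(\{\!\{v_1\}\!\}^2+\{\!\{v_2\}\!\}^2+\{\!\{v_3\}\!\}^2-\tfrac12\big(\{\!\{v_1^2\}\!\}+\{\!\{v_2^2\}\!\}+\{\!\{v_3^2\}\!\}\big)\Big)\end{bmatrix}$$ satisfies the entropy conservation condition in time $$[\![\mathbf W]\!]^T\mathbf U^{\#}=[\![\Phi]\!].$$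
   Context: The conserved Euler state is $\mathbf U=(\rho,\rho v_1,\rho v_2,\rho v_3,E)^T$, with pressure $p=(\gamma-1)\big(E-\frac{\rho}{2}|\vec v|^2\big)$, $|\vec v|^2=v_1^2+v_2^2+v_3^2$, and $\beta=\rho/(2p)$. With $\varsigma=-(\gamma-1)\ln\rho-\ln\beta-\ln 2$, the mathematical entropy is $s=-\rho\varsigma/(\gamma-1)$. The entropy variables are $$\mathbf W=\Big(\frac{\gamma-\varsigma}{\gamma-1}-\beta|\vec v|^2,\;2\beta v_1,\;2\beta v_2,\;2\beta v_3,\;-2\beta\Big)^T,$$ and the temporal entropy potential is $\Phi=\mathbf W^T\mathbf U-s=\rho$. For a quantity $a$ with values $a_-,a_+$ at the two states: $[\![a]\!]=a_+-a_-$ (componentwise for vectors), $\{\!\{a\}\!\}=\frac12(a_++a_-)$, and for positive $a$ the logarithmic mean is $a^{\ln}=[\![a]\!]/[\![\ln a]\!]$, understood as the common value $a_-=a_+$ when $a_-=a_+$. *)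

theory Defs
  imports "HOL-Analysis.Analysis"
begin

(* A conserved state U = (rho, rho v1, rho v2, rho v3, E) is a vector in real^5 with entries
   U $ 1, ..., U $ 5.  The index 5 of the numeral type 5 equals 0, but 1, ..., 5 are distinct.
   The functions below are meant for U $ 1 > 0 and positive pressure. *)

type_synonym euler_state = "real ^ 5"

definition rho :: "euler_state \<Rightarrow> real" where
  "rho U = U $ 1"

definition velocity :: "euler_state \<Rightarrow> real ^ 3" where
  "velocity U = vector [U $ 2 / U $ 1, U $ 3 / U $ 1, U $ 4 / U $ 1]"

definition speed_sq :: "euler_state \<Rightarrow> real" where
  "speed_sq U = (velocity U $ 1)\<^sup>2 + (velocity U $ 2)\<^sup>2 + (velocity U $ 3)\<^sup>2"

definition pressure :: "real \<Rightarrow> euler_state \<Rightarrow> real" where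
  "pressure \<gamma> U = (\<gamma> - 1) * (U $ 5 - rho U / 2 * speed_sq U)"

definition beta :: "real \<Rightarrow> euler_state \<Rightarrow> real" where
  "beta \<gamma> U = rho U / (2 * pressure \<gamma> U)"

definition physical_entropy :: "real \<Rightarrow> euler_state \<Rightarrow> real" where
  "physical_entropy \<gamma> U = - (\<gamma> - 1) * ln (rho U) - ln (beta \<gamma> U) - ln 2"

definition math_entropy :: "real \<Rightarrow> euler_state \<Rightarrow> real" where
  "math_entropy \<gamma> U = - (rho U * physical_entropy \<gamma> U) / (\<gamma> - 1)"

definition entropy_variables :: "real \<Rightarrow> euler_state \<Rightarrow> real ^ 5" where
  "entropy_variables \<gamma> U = vector
     [(\<gamma> - physical_entropy \<gamma> U) / (\<gamma> - 1) - beta \<gamma> U * speed_sq U,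
      2 * beta \<gamma> U * velocity U $ 1,
      2 * beta \<gamma> U * velocity U $ 2,
      2 * beta \<gamma> U * velocity U $ 3,
      - 2 * beta \<gamma> U]"

definition entropy_potential :: "real \<Rightarrow> euler_state \<Rightarrow> real" where
  "entropy_potential \<gamma> U = entropy_variables \<gamma> U \<bullet> U - math_entropy \<gamma> U"

(* Jumps and means of a quantity q, given as a function of the state, between the states
   Um (subscript minus) and Up (subscript plus). *)

definition jump :: "(euler_state \<Rightarrow> 'a::real_vector) \<Rightarrow> euler_state \<Rightarrow> euler_state \<Rightarrow> 'a" where
  "jump q Um Up = q Up - q Um"

definition mean :: "(euler_state \<Rightarrow> real) \<Rightarrow> euler_state \<Rightarrow> euler_state \<Rightarrow> real" where
  "mean q Um Up = (q Up + q Um) / 2"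

definition log_mean :: "(euler_state \<Rightarrow> real) \<Rightarrow> euler_state \<Rightarrow> euler_state \<Rightarrow> real" where
  "log_mean q Um Up =
     (if q Um = q Up then q Um else jump q Um Up / jump (\<lambda>U. ln (q U)) Um Up)"

definition temporal_state :: "real \<Rightarrow> euler_state \<Rightarrow> euler_state \<Rightarrow> euler_state" where
  "temporal_state \<gamma> Um Up =
    (let rho_ln = log_mean rho Um Up;
         beta_ln = log_mean (beta \<gamma>) Um Up;
         v = (\<lambda>j. mean (\<lambda>U. velocity U $ j) Um Up);
         vsq = (\<lambda>j. mean (\<lambda>U. (velocity U $ j)\<^sup>2) Um Up)
     in vector
       [rho_ln,
        rho_ln * v 1,
        rho_ln * v 2,
        rho_ln * v 3,
        rho_ln / (2 * beta_ln * (\<gamma> - 1))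
          + rho_ln * ((v 1)\<^sup>2 + (v 2)\<^sup>2 + (v 3)\<^sup>2 - (vsq 1 + vsq 2 + vsq 3) / 2)])"

lemma UNIV_5: "(UNIV :: 5 set) = {1, 2, 3, 4, 5}"
proof -
  have "card {1, 2, 3, 4, 5 :: 5} = CARD(5)"
    by simp
  then show ?thesis
    by (metis card_subset_eq finite_class.finite_UNIV subset_UNIV)
qed

lemma vector_5 [simp]:
  "(vector [a, b, c, d, e] :: ('a::zero) ^ 5) $ 1 = a"
  "(vector [a, b, c, d, e] :: 'a ^ 5) $ 2 = b"
  "(vector [a, b, c, d, e] :: 'a ^ 5) $ 3 = c"
  "(vector [a, b, c, d, e] :: 'a ^ 5) $ 4 = d"
  "(vector [a, b, c, d, e] :: 'a ^ 5) $ 5 = e"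
  unfolding vector_def by auto

lemma inner_5:
  "(x :: real ^ 5) \<bullet> y = x $ 1 * y $ 1 + x $ 2 * y $ 2 + x $ 3 * y $ 3 + x $ 4 * y $ 4 + x $ 5 * y $ 5"
  unfolding inner_vec_def UNIV_5 by simp

lemma entropy_potential_eq_rho:
  assumes "\<gamma> > 1" "rho U > 0" "pressure \<gamma> U > 0"
  shows "entropy_potential \<gamma> U = rho U"
proof -
  define r b v1 v2 v3 z where defs: "r = rho U" "b = beta \<gamma> U" "v1 = velocity U $ 1"
    "v2 = velocity U $ 2" "v3 = velocity U $ 3" "z = physical_entropy \<gamma> U"
  have r: "r > 0" and b: "b > 0"
    using assms by (auto simp: defs beta_def)
  have U: "U $ 1 = r" "U $ 2 = r * v1" "U $ 3 = r * v2" "U $ 4 = r * v3"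
    using r by (auto simp: defs rho_def velocity_def)
  have p: "2 * b * pressure \<gamma> U = r"
    using assms by (simp add: defs beta_def)
  have "2 * b * U $ 5 = r / (\<gamma> - 1) + b * r * (v1\<^sup>2 + v2\<^sup>2 + v3\<^sup>2)"
    using p assms(1) by (simp add: pressure_def speed_sq_def defs field_simps)
  then have "entropy_potential \<gamma> U = r * ((\<gamma> - z) / (\<gamma> - 1)) - r / (\<gamma> - 1) + r * z / (\<gamma> - 1)"
    unfolding entropy_potential_def inner_5 entropy_variables_def math_entropy_def vector_5 U
      speed_sq_def defs(2-6)[symmetric] defs(1)[symmetric]
    by (simp add: algebra_simps power2_eq_square)
  also have "\<dots> = r"
  proof -
    have "r * ((\<gamma> - z) / (\<gamma> - 1)) - r / (\<gamma> - 1) + r * z / (\<gamma> - 1) = r * (\<gamma> - 1) / (\<gamma> - 1)"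
      unfolding times_divide_eq_right diff_divide_distrib[symmetric] add_divide_distrib[symmetric]
      by (simp add: algebra_simps)
    then show ?thesis
      using assms(1) by simp
  qed
  finally show ?thesis
    by (simp add: defs)
qed

end

theory Submission
  imports Defs
begin

text \<open>
  Both sides of the claim equal the jump of \<open>\<rho>\<close>; on the right this is
  \<open>entropy_potential_eq_rho\<close>. On the left, the physical entropy is split into logarithms, so
  that the first component of the entropy variables jumps by
  \<open>\<lbrakk>ln \<rho>\<rbrakk> + \<lbrakk>ln \<beta>\<rbrakk> / (\<gamma> - 1) - \<lbrakk>\<beta> |v|\<^sup>2\<rbrakk>\<close> (lemma \<open>jump_entropy_variable_1\<close>).
  Every component of the temporal state contains the factor \<open>\<rho>\<^sup>l\<^sup>n\<close>, the logarithmic mean, and the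
  inner product is this factor times a sum of three groups:

  \<^item> \<open>\<lbrakk>ln \<rho>\<rbrakk>\<close>, which the factor turns into \<open>\<lbrakk>\<rho>\<rbrakk>\<close>, since the logarithmic mean is made for that
    (lemma \<open>log_mean_times_jump_ln\<close>);
  \<^item> the thermal terms \<open>\<lbrakk>ln \<beta>\<rbrakk> / (\<gamma> - 1)\<close> and \<open>- \<lbrakk>\<beta>\<rbrakk> / (\<beta>\<^sup>l\<^sup>n (\<gamma> - 1))\<close>, which cancel by the same
    property of the logarithmic mean of \<open>\<beta>\<close>;
  \<^item> the kinetic terms, which cancel separately for each velocity component by the product rule
    for jumps (lemma \<open>jump_kinetic_cancel\<close>).
\<close>

text \<open>
  A logarithmic mean of positive values is positive because \<open>ln\<close> is strictly increasing, so that
  numerator and denominator of the quotient have the same sign.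
\<close>

lemma log_mean_pos:
  assumes "q Um > 0" "q Up > 0"
  shows "log_mean q Um Up > 0"
proof (cases "q Um" "q Up" rule: linorder_cases)
  case less
  then show ?thesis
    using assms by (simp add: log_mean_def jump_def)
next
  case equal
  then show ?thesis
    using assms by (simp add: log_mean_def)
next
  case greater
  then show ?thesis
    using assms by (simp add: log_mean_def jump_def divide_neg_neg)
qed

text \<open>
  The logarithmic mean is the discrete chain rule for \<open>ln\<close>. For equal values both jumps vanish;
  otherwise the denominator is nonzero because \<open>ln\<close> is injective on positive numbers.
\<close>

lemma log_mean_times_jump_ln:
  assumes "q Um > 0" "q Up > 0"
  shows "log_mean q Um Up * jump (\<lambda>U. ln (q U)) Um Up = jump q Um Up"
  using assms by (auto simp: log_mean_def jump_def)

text \<open>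
  With \<open>\<lbrakk>a b\<rbrakk> = \<lbrakk>a\<rbrakk> {b} + {a} \<lbrakk>b\<rbrakk>\<close>, where \<open>{a}\<close> is the arithmetic mean, the parts proportional to
  \<open>\<lbrakk>v\<rbrakk>\<close> cancel because \<open>\<lbrakk>v\<^sup>2\<rbrakk> = 2 {v} \<lbrakk>v\<rbrakk>\<close>. What remains is
  \<open>\<lbrakk>b\<rbrakk> (2 {v}\<^sup>2 - {v\<^sup>2})\<close>, which explains the combination of means in the energy component.
\<close>

lemma jump_kinetic_cancel:
  "2 * jump (\<lambda>U. b U * v U) Um Up * mean v Um Up - jump (\<lambda>U. b U * (v U)\<^sup>2) Um Up
    = 2 * jump b Um Up * ((mean v Um Up)\<^sup>2 - mean (\<lambda>U. (v U)\<^sup>2) Um Up / 2)"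
  by (simp add: jump_def mean_def field_simps power2_eq_square)

lemma entropy_variable_1:
  assumes "\<gamma> > 1"
  shows "entropy_variables \<gamma> U $ 1
    = ln (rho U) + ln (beta \<gamma> U) / (\<gamma> - 1) - beta \<gamma> U * speed_sq U + (\<gamma> + ln 2) / (\<gamma> - 1)"
proof -
  have "(\<gamma> - physical_entropy \<gamma> U) / (\<gamma> - 1)
      = ((\<gamma> - 1) * ln (rho U) + ln (beta \<gamma> U) + (\<gamma> + ln 2)) / (\<gamma> - 1)"
    by (simp add: physical_entropy_def algebra_simps)
  also have "\<dots> = ln (rho U) + ln (beta \<gamma> U) / (\<gamma> - 1) + (\<gamma> + ln 2) / (\<gamma> - 1)"
    using assms by (simp add: add_divide_distrib)
  finally show ?thesis
    by (simp add: entropy_variables_def)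
qed

lemma jump_entropy_variable_1:
  assumes "\<gamma> > 1"
  shows "jump (entropy_variables \<gamma>) Um Up $ 1
    = jump (\<lambda>U. ln (rho U)) Um Up + jump (\<lambda>U. ln (beta \<gamma> U)) Um Up / (\<gamma> - 1)
      - (jump (\<lambda>U. beta \<gamma> U * (velocity U $ 1)\<^sup>2) Um Up
         + jump (\<lambda>U. beta \<gamma> U * (velocity U $ 2)\<^sup>2) Um Up
         + jump (\<lambda>U. beta \<gamma> U * (velocity U $ 3)\<^sup>2) Um Up)"
  unfolding jump_def vector_minus_component entropy_variable_1[OF assms] speed_sq_def
  by (simp add: algebra_simps diff_divide_distrib)

lemma jump_entropy_variables_2_to_5:
  "jump (entropy_variables \<gamma>) Um Up $ 2 = 2 * jump (\<lambda>U. beta \<gamma> U * velocity U $ 1) Um Up"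
  "jump (entropy_variables \<gamma>) Um Up $ 3 = 2 * jump (\<lambda>U. beta \<gamma> U * velocity U $ 2) Um Up"
  "jump (entropy_variables \<gamma>) Um Up $ 4 = 2 * jump (\<lambda>U. beta \<gamma> U * velocity U $ 3) Um Up"
  "jump (entropy_variables \<gamma>) Um Up $ 5 = - 2 * jump (beta \<gamma>) Um Up"
  by (simp_all add: jump_def entropy_variables_def)

theorem theorem3:
  fixes \<gamma> :: real and Um Up :: euler_state
  assumes "\<gamma> > 1"
    and "rho Um > 0" and "pressure \<gamma> Um > 0"
    and "rho Up > 0" and "pressure \<gamma> Up > 0"
  shows "jump (entropy_variables \<gamma>) Um Up \<bullet> temporal_state \<gamma> Um Up
           = jump (entropy_potential \<gamma>) Um Up"
proof -
  define R where "R = log_mean rho Um Up"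
  define B where "B = log_mean (beta \<gamma>) Um Up"
  define b where "b = jump (beta \<gamma>) Um Up"
  define lr where "lr = jump (\<lambda>U. ln (rho U)) Um Up"
  define lb where "lb = jump (\<lambda>U. ln (beta \<gamma> U)) Um Up"
  define m where "m j = mean (\<lambda>U. velocity U $ j) Um Up" for j
  define s where "s j = mean (\<lambda>U. (velocity U $ j)\<^sup>2) Um Up" for j
  define p where "p j = jump (\<lambda>U. beta \<gamma> U * velocity U $ j) Um Up" for j
  define k where "k j = jump (\<lambda>U. beta \<gamma> U * (velocity U $ j)\<^sup>2) Um Up" for j
  note folds = R_def[symmetric] B_def[symmetric] b_def[symmetric] lr_def[symmetric]
    lb_def[symmetric] m_def[symmetric] s_def[symmetric] p_def[symmetric] k_def[symmetric]
  have beta_pos: "beta \<gamma> Um > 0" "beta \<gamma> Up > 0"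
    using assms by (simp_all add: beta_def)
  have kinetic: "2 * p j * m j - k j - 2 * b * ((m j)\<^sup>2 - s j / 2) = 0" for j
    unfolding p_def m_def k_def b_def s_def jump_kinetic_cancel by simp
  have "B > 0" and b_eq: "b = B * lb"
    using log_mean_pos log_mean_times_jump_ln beta_pos unfolding B_def lb_def b_def by (blast, metis)
  then have thermal: "lb / (\<gamma> - 1) - 2 * b * (1 / (2 * B * (\<gamma> - 1))) = 0"
    by (simp add: b_eq)
  have "jump (entropy_variables \<gamma>) Um Up \<bullet> temporal_state \<gamma> Um Up
      = (lr + lb / (\<gamma> - 1) - (k 1 + k 2 + k 3)) * R
        + 2 * p 1 * (R * m 1) + 2 * p 2 * (R * m 2) + 2 * p 3 * (R * m 3)
        + (- 2 * b) * (R / (2 * B * (\<gamma> - 1))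
          + R * ((m 1)\<^sup>2 + (m 2)\<^sup>2 + (m 3)\<^sup>2 - (s 1 + s 2 + s 3) / 2))"
    unfolding inner_5 jump_entropy_variable_1[OF assms(1)] jump_entropy_variables_2_to_5
      temporal_state_def Let_def vector_5 folds ..
  also have "\<dots> = R * (lr + (lb / (\<gamma> - 1) - 2 * b * (1 / (2 * B * (\<gamma> - 1))))
        + (2 * p 1 * m 1 - k 1 - 2 * b * ((m 1)\<^sup>2 - s 1 / 2))
        + (2 * p 2 * m 2 - k 2 - 2 * b * ((m 2)\<^sup>2 - s 2 / 2))
        + (2 * p 3 * m 3 - k 3 - 2 * b * ((m 3)\<^sup>2 - s 3 / 2)))"
    \<comment> \<open>The two quotients are made opaque so that the regrouping is a polynomial identity.\<close>
  proof -
    define x where "x = lb / (\<gamma> - 1)"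
    define y where "y = 1 / (2 * B * (\<gamma> - 1))"
    have R_y: "R / (2 * B * (\<gamma> - 1)) = R * y"
      by (simp add: y_def)
    show ?thesis
      unfolding R_y x_def[symmetric] y_def[symmetric] by (simp add: field_simps)
  qed
  also have "\<dots> = R * lr"
    unfolding thermal kinetic by simp
  also have "\<dots> = jump rho Um Up"
    unfolding R_def lr_def using assms by (intro log_mean_times_jump_ln)
  also have "\<dots> = jump (entropy_potential \<gamma>) Um Up"
    using assms by (simp add: jump_def entropy_potential_eq_rho)
  finally show ?thesis .
qed

end
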